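(* Let $n$ be a positive integer, let $C$ be any subset of $\{1,2,\dots,n\}$, and put $\mu = \sum_{k\in C} 1/k$. Then the proportion of elements of the symmetric group $S_n$ having no cycle with length in $C$ is less than $\exp(\gamma-\mu)$, where $\gamma$ is Euler's constant.
   Context: $S_n$ is the symmetric group on $\{1,2,\dots,n\}$. The cycles of a permutation $\sigma\in S_n$ are the factors in its decomposition as a product of disjoint cycles, with fixed points counted as cycles of length $1$. The proportion of elements of $S_n$ with a property is the number of elements with that property divided by $n!$. Euler's constant is $\gamma=\lim_{n\to\infty}\left(\sum_{k=1}^n \frac1k-\log n\right)$, with $\log$ the natural logarithm. *)

theory Defs
  imports "HOL-Analysis.Harmonic_Numbers" "HOL-Combinatorics.Cycles" "HOL-Combinatorics.Orbits"
begin

text \<open>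
  A decomposition of \<open>p\<close> on \<open>S\<close> into disjoint cycles, each cycle given by the list of the points
  it moves around. Every point of \<open>S\<close> occurs exactly once, so a fixed point \<open>x\<close> appears as the
  one-element list \<open>[x]\<close>, although \<open>cycle_of_list [x] = id\<close>.
\<close>
definition cycle_factorization :: "'a set \<Rightarrow> ('a \<Rightarrow> 'a) \<Rightarrow> 'a list list \<Rightarrow> bool" where
  "cycle_factorization S p css \<longleftrightarrow>
     [] \<notin> set css \<and> distinct (concat css) \<and> set (concat css) = S \<and>
     p = foldr (\<circ>) (map cycle_of_list css) id"

text \<open>
  The factorization is unique up to the order of the factors and rotation of each list, and it
  exists for every permutation of a finite set, so the existential is harmless;
  see \<open>cycle_lengths_eq_card_orbits\<close> below.
\<close>
definition cycle_lengths :: "'a set \<Rightarrow> ('a \<Rightarrow> 'a) \<Rightarrow> nat set" where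
  "cycle_lengths S p = {length cs |cs css. cycle_factorization S p css \<and> cs \<in> set css}"

lemma cycle_factorization_exists:
  assumes "p permutes S" "finite S"
  shows "\<exists>css. cycle_factorization S p css"
  using cycle_decomposition[OF assms]
proof (induction rule: cycle_decomp.induct)
  case empty
  have "cycle_factorization {} id []"
    by (simp add: cycle_factorization_def)
  then show ?case by blast
next
  case (comp I p cs)
  then obtain css where css: "cycle_factorization I p css" by blast
  show ?case
  proof (cases "cs = []")
    case True
    then show ?thesis using css by auto
  next
    case False
    then have "cycle_factorization (set cs \<union> I) (cycle_of_list cs \<circ> p) (cs # css)"
      using css comp.hyps by (auto simp: cycle_factorization_def)
    then show ?thesis by blast
  qed
qed

lemma foldr_cycles_outside:
  "x \<notin> set (concat css) \<Longrightarrow> foldr (\<circ>) (map cycle_of_list css) id x = x"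
  by (induction css) (auto simp: id_outside_supp)

lemma foldr_cycles_apply:
  assumes "distinct (concat css)" "cs \<in> set css" "x \<in> set cs"
  shows "foldr (\<circ>) (map cycle_of_list css) id x = cycle_of_list cs x"
  using assms
proof (induction css)
  case (Cons ds css)
  show ?case
  proof (cases "x \<in> set ds")
    case True
    then have "x \<notin> set (concat css)" using Cons.prems by auto
    moreover from this have "cs = ds" using Cons.prems by auto
    moreover from calculation(1) have "foldr (\<circ>) (map cycle_of_list css) id x = x"
      by (rule foldr_cycles_outside)
    moreover have "foldr (\<circ>) (map cycle_of_list (ds # css)) id x
        = cycle_of_list ds (foldr (\<circ>) (map cycle_of_list css) id x)"
      by simp
    ultimately show ?thesis by metis
  next
    case False
    then have cs: "cs \<in> set css" using Cons.prems by auto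
    have "cycle_of_list cs x \<in> set cs"
      using Cons.prems(3) cycle_permutes permutes_in_image by metis
    then have "cycle_of_list cs x \<notin> set ds" using cs Cons.prems(1) by auto
    then show ?thesis using Cons cs by (simp add: id_outside_supp)
  qed
qed simp

lemma orbit_cycle_of_list:
  assumes "distinct cs" "x \<in> set cs"
  shows "orbit (cycle_of_list cs) x = set cs"
proof -
  obtain i where i: "i < length cs" "x = cs ! i"
    using assms(2) by (auto simp: in_set_conv_nth)
  have pow: "(cycle_of_list cs ^^ m) x = cs ! ((m + i) mod length cs)" for m
  proof -
    have "(cycle_of_list cs ^^ m) x = map (cycle_of_list cs ^^ m) cs ! i"
      using i by simp
    also have "\<dots> = cs ! ((m + i) mod length cs)"
      using cyclic_rotation[OF assms(1), of m] i by (simp add: nth_rotate add.commute)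
    finally show ?thesis .
  qed
  have "orbit (cycle_of_list cs) x = {(cycle_of_list cs ^^ m) x | m. True}"
    by (rule orbit_altdef_permutation) (rule permutation_of_cycle)
  also have "\<dots> = set cs"
  proof (intro set_eqI iffI)
    fix y assume "y \<in> {(cycle_of_list cs ^^ m) x | m. True}"
    then show "y \<in> set cs" using pow i by (auto intro!: nth_mem mod_less_divisor)
  next
    fix y assume "y \<in> set cs"
    then obtain j where j: "j < length cs" "y = cs ! j" by (auto simp: in_set_conv_nth)
    have "length cs - i + j + i = length cs + j" using i by simp
    then have "(cycle_of_list cs ^^ (length cs - i + j)) x = y"
      using j by (simp only: pow) simp
    then show "y \<in> {(cycle_of_list cs ^^ m) x | m. True}" by blast
  qed
  finally show ?thesis .
qed

lemma cycle_factorization_orbit: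
  assumes "cycle_factorization S p css" "cs \<in> set css" "x \<in> set cs"
  shows "orbit p x = set cs"
proof -
  have dist: "distinct (concat css)" and p: "p = foldr (\<circ>) (map cycle_of_list css) id"
    using assms(1) by (auto simp: cycle_factorization_def)
  have "p y = cycle_of_list cs y" if "y \<in> set cs" for y
    using foldr_cycles_apply[OF dist assms(2) that] p by simp
  moreover have "cycle_of_list cs \<in> set cs \<rightarrow> set cs"
    using permutes_in_image[OF cycle_permutes[of cs]] by blast
  ultimately have "orbit p x = orbit (cycle_of_list cs) x"
    using assms(3) by (intro orbit_cong0[of _ "set cs"]) auto
  also have "\<dots> = set cs"
    using dist assms(2,3) by (intro orbit_cycle_of_list) (auto simp: distinct_concat_iff)
  finally show ?thesis .
qed

lemma cycle_lengths_eq_card_orbits: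
  assumes "p permutes S" "finite S"
  shows "cycle_lengths S p = (\<lambda>x. card (orbit p x)) ` S"
proof (intro set_eqI iffI)
  fix k assume "k \<in> cycle_lengths S p"
  then obtain cs css where c: "cycle_factorization S p css" "cs \<in> set css" "k = length cs"
    by (auto simp: cycle_lengths_def)
  then have "cs \<noteq> []" "distinct cs" "set cs \<subseteq> S"
    by (auto simp: cycle_factorization_def distinct_concat_iff)
  moreover from this obtain x where "x \<in> set cs" by (cases cs) auto
  ultimately show "k \<in> (\<lambda>x. card (orbit p x)) ` S"
    using cycle_factorization_orbit[OF c(1,2)] c(3) by (auto simp: distinct_card intro!: rev_image_eqI)
next
  fix k assume "k \<in> (\<lambda>x. card (orbit p x)) ` S"
  then obtain x where x: "x \<in> S" "k = card (orbit p x)" by blast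
  obtain css where css: "cycle_factorization S p css"
    using cycle_factorization_exists[OF assms] by blast
  then obtain cs where cs: "cs \<in> set css" "x \<in> set cs" "distinct cs"
    using x(1) by (fastforce simp: cycle_factorization_def distinct_concat_iff)
  then have "k = length cs"
    using cycle_factorization_orbit[OF css cs(1,2)] x(2) by (simp add: distinct_card)
  then show "k \<in> cycle_lengths S p"
    using css cs(1) by (auto simp: cycle_lengths_def)
qed

end

theory Submission
  imports Defs "HOL-Computational_Algebra.Formal_Power_Series"
begin

text \<open>
  Let \<open>A = {1..n} - C\<close>, let \<open>a\<^sub>m\<close> be the proportion of permutations of \<open>m\<close> points with all cycle
  lengths in \<open>A\<close>, and let \<open>T = exp (\<Sum>k\<in>A. 1 / k)\<close>. Removing the cycle through a chosen point gives
  \<open>m * a\<^sub>m = (\<Sum>k\<in>A. a\<^bsub>m-k\<^esub>)\<close>, the recursion satisfied by the coefficients of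
  \<open>exp (\<Sum>k\<in>A. X^k / k)\<close>. Hence \<open>n * a\<^sub>n \<le> (\<Sum>j<n. a\<^sub>j)\<close>, that is
  \<open>(n + 1) * a\<^sub>n \<le> (\<Sum>j\<le>n. a\<^sub>j) \<le> T\<close>. Since \<open>T = exp (harm n - \<mu>)\<close>, the theorem follows from
  \<open>harm n - ln (n + 1) < \<gamma>\<close>.
\<close>

text \<open>The ground set is arbitrary because deleting the cycle through a point of
  \<open>{1..n}\<close> leaves a general subset, to which the induction has to apply.\<close>

definition cycle_perms :: "nat set \<Rightarrow> 'a set \<Rightarrow> ('a \<Rightarrow> 'a) set" where
  "cycle_perms A S = {p. p permutes S \<and> cycle_lengths S p \<subseteq> A}"

text \<open>For \<open>A\<close> finite without 0 this is exp of the sum of X^k / k over k in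
  \<open>A\<close>. The product form allows bounds to be proved one factor at a time, by induction
  on \<open>A\<close>.\<close>

definition cycle_fps :: "nat set \<Rightarrow> real fps" where
  "cycle_fps A = (\<Prod>k\<in>A. fps_exp (1 / real k) oo fps_X ^ k)"

section \<open>The generating function\<close>

text \<open>Since k > 0, m = k * i forces i \<le> m, so the range of i can be extended to a bound
  \<open>n\<close> common to all m. This makes the double sum over m and i rectangular and its order
  exchangeable.\<close>

lemma fps_exp_compose_X_power_nth:
  assumes "k > 0" "m \<le> n"
  shows "fps_nth (fps_exp (c::real) oo fps_X ^ k) m = (\<Sum>i\<le>n. if m = k * i then c ^ i / fact i else 0)"
proof -
  have "fps_nth (fps_exp c oo fps_X ^ k) m = (\<Sum>i=0..m. if m = k * i then c ^ i / fact i else 0)"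
    unfolding fps_compose_nth
    by (intro sum.cong refl) (auto simp: power_mult[symmetric] fps_X_power_nth)
  also have "\<dots> = (\<Sum>i\<le>n. if m = k * i then c ^ i / fact i else 0)"
    using assms by (intro sum.mono_neutral_left) auto
  finally show ?thesis .
qed

lemma fps_exp_compose_X_power_nonneg:
  assumes "k > 0" "c \<ge> 0"
  shows "fps_nth (fps_exp (c::real) oo fps_X ^ k) m \<ge> 0"
  using assms by (subst fps_exp_compose_X_power_nth[of k m m]) (auto intro!: sum_nonneg)

lemma sum_fps_exp_compose_X_power_le:
  assumes "k > 0" "c \<ge> 0"
  shows "(\<Sum>m\<le>n. fps_nth (fps_exp (c::real) oo fps_X ^ k) m) \<le> exp c"
proof -
  have "(\<Sum>m\<le>n. fps_nth (fps_exp c oo fps_X ^ k) m)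
      = (\<Sum>m\<le>n. \<Sum>i\<le>n. if m = k * i then c ^ i / fact i else 0)"
    using assms by (intro sum.cong refl fps_exp_compose_X_power_nth) auto
  also have "\<dots> = (\<Sum>i\<le>n. \<Sum>m\<le>n. if m = k * i then c ^ i / fact i else 0)"
    by (rule sum.swap)
  \<comment> \<open>Each i is matched by at most one m, namely k * i, and the terms are
    nonnegative.\<close>
  also have "\<dots> \<le> (\<Sum>i\<le>n. c ^ i / fact i)"
    using assms by (intro sum_mono) auto
  also have "\<dots> \<le> (\<Sum>i. c ^ i / fact i)"
    using assms summable_exp[of c]
    by (intro sum_le_suminf) (auto simp: divide_inverse mult.commute)
  also have "\<dots> = exp c"
    by (simp add: exp_def divide_inverse mult.commute)
  finally show ?thesis .
qed

text \<open>The left side sums over the triangle i + j \<le> n, the right side over the square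
  containing it, and the additional products are nonnegative.\<close>

lemma sum_fps_mult_nth_le:
  fixes f g :: "real fps"
  assumes "\<And>m. fps_nth f m \<ge> 0" "\<And>m. fps_nth g m \<ge> 0"
  shows "(\<Sum>m\<le>n. fps_nth (f * g) m) \<le> (\<Sum>m\<le>n. fps_nth f m) * (\<Sum>m\<le>n. fps_nth g m)"
proof -
  have "(\<Sum>m\<le>n. fps_nth (f * g) m) = (\<Sum>m\<le>n. \<Sum>i\<le>m. fps_nth f i * fps_nth g (m - i))"
    by (simp add: fps_mult_nth atLeast0AtMost)
  also have "\<dots> = (\<Sum>(i, j)\<in>{(i, j). i + j \<le> n}. fps_nth f i * fps_nth g j)"
    by (rule sum.triangle_reindex_eq[symmetric])
  also have "\<dots> \<le> (\<Sum>(i, j)\<in>{..n} \<times> {..n}. fps_nth f i * fps_nth g j)"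
    using assms by (intro sum_mono2) auto
  also have "\<dots> = (\<Sum>m\<le>n. fps_nth f m) * (\<Sum>m\<le>n. fps_nth g m)"
    by (simp add: sum_product sum.cartesian_product)
  finally show ?thesis .
qed

lemma cycle_fps_nonneg:
  assumes "finite A" "0 \<notin> A"
  shows "fps_nth (cycle_fps A) m \<ge> 0"
  using assms
proof (induction A arbitrary: m rule: finite_induct)
  case (insert k A)
  then have "k > 0" by auto
  then show ?case
    using insert by (auto simp: cycle_fps_def fps_mult_nth
        intro!: sum_nonneg mult_nonneg_nonneg fps_exp_compose_X_power_nonneg)
qed (simp add: cycle_fps_def)

text \<open>A truncated form of evaluation at X = 1: the bounds for the single factors multiply, so
  the convergence of the full series never enters.\<close>

lemma sum_cycle_fps_le:
  assumes "finite A" "0 \<notin> A"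
  shows "(\<Sum>m\<le>n. fps_nth (cycle_fps A) m) \<le> exp (\<Sum>k\<in>A. 1 / real k)"
  using assms
proof (induction A rule: finite_induct)
  case empty
  then show ?case by (simp add: cycle_fps_def)
next
  case (insert k A)
  let ?e = "fps_exp (1 / real k) oo fps_X ^ k"
  have k: "k > 0" using insert by auto
  have "(\<Sum>m\<le>n. fps_nth (cycle_fps (insert k A)) m) = (\<Sum>m\<le>n. fps_nth (?e * cycle_fps A) m)"
    using insert by (simp add: cycle_fps_def)
  also have "\<dots> \<le> (\<Sum>m\<le>n. fps_nth ?e m) * (\<Sum>m\<le>n. fps_nth (cycle_fps A) m)"
    using k insert by (intro sum_fps_mult_nth_le fps_exp_compose_X_power_nonneg cycle_fps_nonneg) auto
  also have "\<dots> \<le> exp (1 / real k) * exp (\<Sum>k\<in>A. 1 / real k)"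
    using k insert
    by (intro mult_mono sum_fps_exp_compose_X_power_le insert.IH sum_nonneg cycle_fps_nonneg) auto
  also have "\<dots> = exp (\<Sum>k\<in>insert k A. 1 / real k)"
    using insert by (simp add: exp_add)
  finally show ?case .
qed

lemma fps_deriv_exp_compose_X_power:
  assumes "k > 0"
  shows "fps_deriv (fps_exp (1 / real k) oo fps_X ^ k)
       = fps_X ^ (k - 1) * (fps_exp (1 / real k) oo fps_X ^ k)"
proof -
  have X0: "fps_nth (fps_X ^ k :: real fps) 0 = 0"
    using assms by simp
  have "fps_deriv (fps_exp (1 / real k) oo fps_X ^ k)
      = fps_const (1 / real k) * (fps_exp (1 / real k) oo fps_X ^ k)
        * (fps_const (real k) * fps_X ^ (k - 1))"
    unfolding fps_compose_deriv[OF X0] fps_exp_deriv fps_compose_mult_distrib[OF X0] fps_deriv_power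
    by simp
  also have "\<dots> = fps_const (1 / real k * real k)
        * (fps_X ^ (k - 1) * (fps_exp (1 / real k) oo fps_X ^ k))"
    by (simp only: fps_const_mult[symmetric] mult_ac)
  finally show ?thesis
    using assms by simp
qed

text \<open>Logarithmic derivatives add over the product, and the factor for k contributes
  X^(k-1).\<close>

lemma fps_deriv_cycle_fps:
  assumes "finite A" "0 \<notin> A"
  shows "fps_deriv (cycle_fps A) = (\<Sum>k\<in>A. fps_X ^ (k - 1)) * cycle_fps A"
  using assms
proof (induction A rule: finite_induct)
  case (insert k A)
  then show ?case
    by (simp add: cycle_fps_def fps_deriv_exp_compose_X_power algebra_simps)
qed (simp add: cycle_fps_def)

text \<open>Compare the coefficients of X^(m-1) on both sides of the differential equation
  \<open>fps_deriv_cycle_fps\<close>.\<close>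

lemma cycle_fps_rec:
  assumes "finite A" "0 \<notin> A" "m > 0"
  shows "real m * fps_nth (cycle_fps A) m
       = (\<Sum>k | k \<in> A \<and> k \<le> m. fps_nth (cycle_fps A) (m - k))"
proof -
  obtain n where m: "m = Suc n"
    using \<open>m > 0\<close> gr0_implies_Suc by blast
  have "real m * fps_nth (cycle_fps A) m = fps_nth (fps_deriv (cycle_fps A)) n"
    by (simp add: m)
  also have "\<dots> = (\<Sum>k\<in>A. if n < k - 1 then 0 else fps_nth (cycle_fps A) (n - (k - 1)))"
    using assms by (simp add: fps_deriv_cycle_fps sum_distrib_right fps_sum_nth fps_X_power_mult_nth
        del: One_nat_def)
  also have "\<dots> = (\<Sum>k\<in>A. if k \<le> m then fps_nth (cycle_fps A) (m - k) else 0)"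
  proof (intro sum.cong refl)
    fix k assume "k \<in> A"
    \<comment> \<open>At k = 0 the truncated difference k - 1 would be 0 and the index shift would
      fail.\<close>
    then have "k \<noteq> 0" using assms by metis
    then show "(if n < k - 1 then 0 else fps_nth (cycle_fps A) (n - (k - 1)))
        = (if k \<le> m then fps_nth (cycle_fps A) (m - k) else 0)"
      by (cases k) (auto simp: m)
  qed
  also have "\<dots> = (\<Sum>k | k \<in> A \<and> k \<le> m. fps_nth (cycle_fps A) (m - k))"
    using assms by (simp add: sum.inter_filter)
  finally show ?thesis .
qed

lemma cycle_fps_nth_0: "finite A \<Longrightarrow> fps_nth (cycle_fps A) 0 = 1"
  by (induction A rule: finite_induct) (auto simp: cycle_fps_def)

lemma cycle_fps_nth_le:
  assumes "finite A" "0 \<notin> A" "n > 0"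
  shows "(real n + 1) * fps_nth (cycle_fps A) n \<le> exp (\<Sum>k\<in>A. 1 / real k)"
proof -
  let ?a = "fps_nth (cycle_fps A)"
  have "real n * ?a n = (\<Sum>k | k \<in> A \<and> k \<le> n. ?a (n - k))"
    using assms by (rule cycle_fps_rec)
  \<comment> \<open>The map k \<mapsto> n - k is injective for k \<le> n, so each earlier
    coefficient occurs at most once.\<close>
  also have "\<dots> = (\<Sum>j\<in>(\<lambda>k. n - k) ` {k \<in> A. k \<le> n}. ?a j)"
    by (subst sum.reindex) (auto simp: inj_on_def)
  also have "\<dots> \<le> (\<Sum>j<n. ?a j)"
  proof (rule sum_mono2)
    show "(\<lambda>k. n - k) ` {k \<in> A. k \<le> n} \<subseteq> {..<n}"
      using assms by (auto simp: image_iff intro!: diff_less) (metis gr0I)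
  qed (use assms cycle_fps_nonneg in auto)
  \<comment> \<open>Adding a further \<open>?a n\<close> to both sides turns the factor n into n +
    1.\<close>
  finally have "(real n + 1) * ?a n \<le> (\<Sum>j\<le>n. ?a j)"
    by (simp add: algebra_simps lessThan_Suc_atMost[symmetric])
  also have "\<dots> \<le> exp (\<Sum>k\<in>A. 1 / real k)"
    using assms by (intro sum_cycle_fps_le)
  finally show ?thesis .
qed

section \<open>Counting permutations by the cycle through a point\<close>

text \<open>Here \<open>support p x\<close> lists the cycle through \<open>x\<close>, starting at
  \<open>x\<close>, and q is p restricted to the remaining points. The resulting pairs (t, q) cover
  \<open>cycle_perms A S\<close>, which is what an upper bound on its size requires.\<close>

lemma cycle_perms_remove_cycle:
  assumes "p \<in> cycle_perms A S" "finite S" "x \<in> S"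
  obtains t q where "distinct t" "set t \<subseteq> S - {x}" "Suc (length t) \<in> A"
    "q \<in> cycle_perms A (S - {x} - set t)" "p = cycle_of_list (x # t) \<circ> q"
proof -
  have p: "p permutes S" and len: "(\<lambda>y. card (orbit p y)) ` S \<subseteq> A"
    using assms cycle_lengths_eq_card_orbits[of p S] by (auto simp: cycle_perms_def)
  have perm: "permutation p"
    using p assms(2) permutation_permutes by blast
  define cs where "cs = support p x"
  define q where "q = (\<lambda>y. if y \<in> S - set cs then p y else y)"
  have "cs = x # tl cs"
    using least_power_of_permutation(2)[OF perm, of x] by (simp add: cs_def upt_conv_Cons)
  then obtain t where t: "cs = x # t" by blast
  have dist: "distinct cs"
    unfolding cs_def by (rule cycle_of_permutation[OF perm])
  have orb: "set cs = orbit p x"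
    unfolding cs_def support_set[OF perm] orbit_altdef_permutation[OF perm] by auto
  have sub: "set cs \<subseteq> S"
    using permutes_in_image[OF permutes_funpow[OF p]] assms(3) by (auto simp: cs_def)
  have q: "q permutes S - set cs"
    unfolding q_def cs_def by (rule semidecomposition[OF p assms(2)])
  have "length cs \<in> A"
    using len assms(3) dist orb by (metis distinct_card image_subset_iff)
  have pq: "p = cycle_of_list cs \<circ> q"
  proof
    fix y
    consider "y \<in> set cs" | "y \<in> S - set cs" | "y \<notin> S" by blast
    then show "p y = (cycle_of_list cs \<circ> q) y"
    proof cases
      case 1
      then show ?thesis using cycle_restrict[OF perm, of y x, folded cs_def] by (simp add: q_def)
    next
      case 2
      then have "q y \<in> S - set cs" using permutes_in_image[OF q] by blast
      then show ?thesis using 2 by (simp add: q_def id_outside_supp)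
    next
      case 3
      then have "y \<notin> set cs" using sub by blast
      then show ?thesis using 3 permutes_not_in[OF p] by (simp add: q_def id_outside_supp)
    qed
  qed
  \<comment> \<open>On the invariant set \<open>S - set cs\<close> the maps p and q agree, so the
    remaining cycle lengths are inherited from p.\<close>
  have "orbit q y = orbit p y" if "y \<in> S - set cs" for y
    using that permutes_in_image[OF q] by (intro orbit_cong0[of _ "S - set cs"]) (auto simp: q_def)
  then have "cycle_lengths (S - set cs) q \<subseteq> A"
    using len assms(2) by (subst cycle_lengths_eq_card_orbits[OF q]) auto
  with q have "q \<in> cycle_perms A (S - set cs)"
    by (simp add: cycle_perms_def)
  moreover have "S - set cs = S - {x} - set t"
    using t by auto
  ultimately show thesis
    using that[of t q] dist sub \<open>length cs \<in> A\<close> pq t by auto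
qed

lemma finite_cycle_perms: "finite S \<Longrightarrow> finite (cycle_perms A S)"
  by (rule finite_subset[OF _ finite_permutations]) (auto simp: cycle_perms_def)

text \<open>The number of lists is a falling factorial; multiplying by the missing factorial avoids
  division.\<close>

lemma fact_mult_card_distinct_lists:
  assumes "finite T" "i \<le> card T"
  shows "fact (card T - i) * card {xs. length xs = i \<and> distinct xs \<and> set xs \<subseteq> T} = fact (card T)"
proof -
  have "{1..card T} = {1..card T - i} \<union> {card T - i + 1..card T}"
    using assms by auto
  then have "\<Prod>{1..card T} = \<Prod>{1..card T - i} * \<Prod>{card T - i + 1..card T}"
    by (simp add: prod.union_disjoint)
  then show ?thesis
    unfolding card_lists_distinct_length_eq[OF assms] by (simp add: fact_prod)
qed

text \<open>Strong induction on the size of \<open>S\<close>: a union bound over the cycle through a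
  fixed point turns the recursion of the coefficients into a bound on the count.\<close>

lemma card_cycle_perms_le:
  assumes "finite A" "0 \<notin> A" "finite S"
  shows "real (card (cycle_perms A S)) \<le> fact (card S) * fps_nth (cycle_fps A) (card S)"
  using \<open>finite S\<close>
proof (induction "card S" arbitrary: S rule: less_induct)
  case less
  let ?a = "fps_nth (cycle_fps A)"
  show ?case
  proof (cases "S = {}")
    case True
    have "cycle_perms A ({} :: 'b set) \<subseteq> {id}"
      by (auto simp: cycle_perms_def)
    then have "card (cycle_perms A ({} :: 'b set)) \<le> card {id :: 'b \<Rightarrow> 'b}"
      by (intro card_mono) auto
    then show ?thesis
      using True assms by (simp add: cycle_fps_nth_0)
  next
    case False
    then obtain x where x: "x \<in> S" by blast
    define m where "m = card S"
    have m: "m > 0" "card (S - {x}) = m - 1"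
      using x less.prems by (auto simp: m_def card_gt_0_iff)
    \<comment> \<open>The k - 1 points that follow \<open>x\<close> in a cycle of length k, in
      cyclic order. Fixing \<open>x\<close> as the start gives one list per cycle.\<close>
    define L where "L k = {t. length t = k - 1 \<and> distinct t \<and> set t \<subseteq> S - {x}}" for k
    define K where "K = {k \<in> A. k \<le> m}"
    have K: "finite K" "\<And>k. k \<in> K \<Longrightarrow> 0 < k \<and> k \<le> m"
      using assms by (auto simp: K_def intro: gr0I)
    have finL: "finite (L k)" for k
      using less.prems by (auto simp: L_def intro: finite_subset[OF _ finite_lists_length_eq[of "S - {x}" "k - 1"]])
    define D where "D k = (SIGMA t:L k. cycle_perms A (S - {x} - set t))" for k
    have finD: "finite (D k)" for k
      using less.prems finL by (auto simp: D_def intro: finite_cycle_perms)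
    let ?f = "\<lambda>(t, q). cycle_of_list (x # t) \<circ> q"
    have "cycle_perms A S \<subseteq> (\<Union>k\<in>K. ?f ` D k)"
    proof
      fix p assume "p \<in> cycle_perms A S"
      then obtain t q where tq: "distinct t" "set t \<subseteq> S - {x}" "Suc (length t) \<in> A"
        "q \<in> cycle_perms A (S - {x} - set t)" "p = cycle_of_list (x # t) \<circ> q"
        using cycle_perms_remove_cycle less.prems x by metis
      have "length t \<le> m - 1"
        using tq(1,2) m(2) less.prems by (metis card_mono distinct_card finite_Diff)
      then have "Suc (length t) \<in> K" "t \<in> L (Suc (length t))"
        using tq m by (auto simp: K_def L_def)
      moreover have "(t, q) \<in> D (Suc (length t))"
        using tq calculation by (simp add: D_def)
      ultimately show "p \<in> (\<Union>k\<in>K. ?f ` D k)"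
        using tq(5) by force
    qed
    then have "card (cycle_perms A S) \<le> card (\<Union>k\<in>K. ?f ` D k)"
      using K finD by (intro card_mono) auto
    also have "\<dots> \<le> (\<Sum>k\<in>K. card (?f ` D k))"
      using K by (intro card_UN_le)
    also have "\<dots> \<le> (\<Sum>k\<in>K. card (D k))"
      using finD by (intro sum_mono card_image_le)
    also have "\<dots> = (\<Sum>k\<in>K. \<Sum>t\<in>L k. card (cycle_perms A (S - {x} - set t)))"
      using finL less.prems by (simp add: D_def finite_cycle_perms)
    finally have "real (card (cycle_perms A S))
        \<le> (\<Sum>k\<in>K. \<Sum>t\<in>L k. real (card (cycle_perms A (S - {x} - set t))))"
      by (simp flip: of_nat_sum)
    also have "\<dots> \<le> (\<Sum>k\<in>K. \<Sum>t\<in>L k. fact (m - k) * ?a (m - k))"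
    proof (intro sum_mono)
      fix k t assume "k \<in> K" "t \<in> L k"
      then have "card (S - {x} - set t) = m - k"
        using m(2) K less.prems by (auto simp: L_def card_Diff_subset distinct_card)
      then show "real (card (cycle_perms A (S - {x} - set t))) \<le> fact (m - k) * ?a (m - k)"
        using less.hyps[of "S - {x} - set t"] less.prems K(2)[OF \<open>k \<in> K\<close>] by (simp add: m_def)
    qed
    \<comment> \<open>There are (m-1)! / (m-k)! lists in \<open>L k\<close>, so the factorial in
      front no longer depends on k and \<open>cycle_fps_rec\<close> applies to the sum.\<close>
    also have "\<dots> = (\<Sum>k\<in>K. fact (m - 1) * ?a (m - k))"
    proof (intro sum.cong refl)
      fix k assume "k \<in> K"
      then have k: "0 < k" "k \<le> m" using K by auto
      then have "fact (m - k) * card (L k) = fact (m - 1)"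
        using fact_mult_card_distinct_lists[of "S - {x}" "k - 1"] m(2) less.prems
        by (simp add: L_def)
      then have "fact (m - k) * real (card (L k)) = fact (m - 1)"
        by (metis of_nat_fact of_nat_mult)
      then show "(\<Sum>t\<in>L k. fact (m - k) * ?a (m - k)) = fact (m - 1) * ?a (m - k)"
        by (simp add: mult_ac)
    qed
    also have "\<dots> = fact (m - 1) * (real m * ?a m)"
      using assms m(1) by (subst cycle_fps_rec) (auto simp: K_def sum_distrib_left)
    also have "\<dots> = fact m * ?a m"
      using m(1) by (simp add: fact_reduce)
    finally show ?thesis by (simp add: m_def)
  qed
qed

section \<open>The bound\<close>

text \<open>The lower bound for Euler's constant has a positive correction term; dropping it gives
  the strict inequality, the only one in the final chain.\<close>

lemma harm_minus_ln_Suc_less: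
  assumes "n > 0"
  shows "harm n - ln (real n + 1) < euler_mascheroni"
proof -
  obtain k where "n = Suc k"
    using assms gr0_implies_Suc by blast
  have "harm n - ln (real n + 1) < harm n - ln (real n + 1) + 1 / real (2 * (k + 2))"
    by simp
  also have "\<dots> \<le> euler_mascheroni"
    using euler_mascheroni_lower[of k] \<open>n = Suc k\<close> by (simp add: add_ac)
  finally show ?thesis .
qed

theorem theorem1:
  fixes n :: nat and C :: "nat set" and \<mu> :: real
  assumes "n > 0"
    and "C \<subseteq> {1..n}"
    and "\<mu> = (\<Sum>k\<in>C. 1 / real k)"
  shows "real (card {\<sigma>. \<sigma> permutes {1..n} \<and> cycle_lengths {1..n} \<sigma> \<inter> C = {}}) / fact n
           < exp (euler_mascheroni - \<mu>)"
proof -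
  define A where "A = {1..n} - C"
  have A: "finite A" "0 \<notin> A" by (auto simp: A_def)
  have "{\<sigma>. \<sigma> permutes {1..n} \<and> cycle_lengths {1..n} \<sigma> \<inter> C = {}} \<subseteq> cycle_perms A {1..n}"
  proof
    fix p assume "p \<in> {\<sigma>. \<sigma> permutes {1..n} \<and> cycle_lengths {1..n} \<sigma> \<inter> C = {}}"
    then have p: "p permutes {1..n}" "cycle_lengths {1..n} p \<inter> C = {}" by auto
    \<comment> \<open>All cycle lengths lie in \<open>{1..n}\<close>, so avoiding \<open>C\<close>
      means lying in \<open>A\<close>.\<close>
    have "card (orbit p x) \<in> {1..n}" if "x \<in> {1..n}" for x
    proof -
      have perm: "permutation p"
        using p(1) permutation_permutes by blast
      have "orbit p x \<subseteq> {1..n}"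
        using permutes_orbit_subset[OF p(1) that] .
      then have "card (orbit p x) \<le> n"
        using card_mono[of "{1..n}" "orbit p x"] by simp
      moreover have "card (orbit p x) > 0"
        using finite_orbit[OF permutation_self_in_orbit[OF perm]] orbit_nonempty[of p x]
        by (simp add: card_gt_0_iff)
      ultimately show ?thesis by simp
    qed
    then have "cycle_lengths {1..n} p \<subseteq> {1..n}"
      unfolding cycle_lengths_eq_card_orbits[OF p(1) finite_atLeastAtMost] by (rule image_subsetI)
    then show "p \<in> cycle_perms A {1..n}"
      using p by (auto simp: cycle_perms_def A_def)
  qed
  then have "real (card {\<sigma>. \<sigma> permutes {1..n} \<and> cycle_lengths {1..n} \<sigma> \<inter> C = {}})
      \<le> real (card (cycle_perms A {1..n}))"
    by (intro of_nat_mono card_mono finite_cycle_perms) auto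
  also have "\<dots> \<le> fact n * fps_nth (cycle_fps A) n"
    using card_cycle_perms_le[OF A, of "{1..n}"] by simp
  finally have "real (card {\<sigma>. \<sigma> permutes {1..n} \<and> cycle_lengths {1..n} \<sigma> \<inter> C = {}}) / fact n
      \<le> fps_nth (cycle_fps A) n"
    by (simp add: divide_le_eq mult.commute)
  also have "\<dots> \<le> exp (\<Sum>k\<in>A. 1 / real k) / (real n + 1)"
    using cycle_fps_nth_le[OF A \<open>n > 0\<close>] by (simp add: field_simps)
  \<comment> \<open>The sum of 1 / k over all of \<open>{1..n}\<close> is \<open>harm n\<close>, and
    leaving out \<open>C\<close> subtracts \<mu>.\<close>
  also have "(\<Sum>k\<in>A. 1 / real k) = harm n - \<mu>"
    using assms(2) by (simp add: A_def assms(3) harm_def sum_diff inverse_eq_divide)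
  also have "exp (harm n - \<mu>) / (real n + 1) = exp (harm n - ln (real n + 1) - \<mu>)"
    by (simp add: exp_diff)
  also have "\<dots> < exp (euler_mascheroni - \<mu>)"
    using harm_minus_ln_Suc_less[OF \<open>n > 0\<close>] by simp
  finally show ?thesis .
qed

end
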